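(* Let $\alpha>0$ be real. For integers $M\ge 2$ put $$q_M:=\frac{\log\left(\frac{\log M}{\log(M+1)}\right)}{\log\left(\frac{M}{M+1}\right)}.$$ Write $s=\sigma+it$ with $\sigma,t\in\mathbb{R}$. The following statements are true: (a) For all $s$ with $\sigma>q_2\alpha+2.6$ we have $\eta^{(\alpha)}(s)\neq 0$. (b) If $q_3\alpha+4\log 3<q_2\alpha-2$, then $\eta^{(\alpha)}(s)\neq 0$ for all $s$ with $q_3\alpha+4\log 3\le\sigma\le q_2\alpha-2$. (c) Let $u\in(0,\infty)$ be a solution of $1-\frac{1}{e^{u}-1}-\frac{1}{e^{u}}\left(1+\frac1u\right)\ge 0$. If $M\in\mathbb{N}$, $M>3$, and $q_M\alpha+(M+1)u\le q_{M-1}\alpha-Mu$, then $\eta^{(\alpha)}(s)\neq 0$ for all $s$ with $q_M\alpha+(M+1)u\le\sigma\le q_{M-1}\alpha-Mu$.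
   Context: $\eta(s)=\sum_{n\ge1}(-1)^{n+1}n^{-s}$ ($\Re s>0$) is the Euler (Dirichlet) eta function. For real $\alpha>0$, $\eta^{(\alpha)}$ denotes its (reverse) Grünwald–Letnikov fractional derivative, which for $\Re(s)>0$ is given by $$\eta^{(\alpha)}(s)=(-1)^{\alpha}\sum_{n=2}^{\infty}(-1)^{n-1}\frac{(\log n)^{\alpha}}{n^{s}},\qquad (-1)^\alpha=e^{i\pi\alpha};$$ for integer $\alpha$ this is the usual derivative. *)

theory Defs
  imports "HOL-Analysis.Analysis"
begin

(* Only meaningful for Re s > 0. The suminf is the limit of the partial sums in the natural
   order, so it covers the conditionally convergent range 0 < Re s \<le> 1 as well. *)
definition dirichlet_eta :: "complex \<Rightarrow> complex" where
  "dirichlet_eta s = (\<Sum>n. (-1) ^ n / of_nat (Suc n) powr s)"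

(* Reverse Gruenwald-Letnikov derivative of order \<alpha>:
     lim_{h -> 0+} (-1)^\<alpha> h^{-\<alpha>} \<Sum>_{k \<ge> 0} (-1)^k binomial(\<alpha>, k) f(s + k h),
   where (-1)^\<alpha> = exp(i pi \<alpha>). The value is unspecified if the limit does not exist.
   Applied to s \<mapsto> n powr (-s) it gives (-1)^\<alpha> (ln n)^\<alpha> n^{-s}, because
   \<Sum>_k (-1)^k binomial(\<alpha>, k) n^{-k h} = (1 - n^{-h})^\<alpha>; applied to the series of
   eta it gives (-1)^\<alpha> \<Sum>_{n \<ge> 2} (-1)^{n-1} (ln n)^\<alpha> n^{-s}. *)
definition rev_GL_deriv :: "real \<Rightarrow> (complex \<Rightarrow> complex) \<Rightarrow> complex \<Rightarrow> complex" where
  "rev_GL_deriv \<alpha> f s = Lim (at_right (0::real))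
     (\<lambda>h. exp (\<i> * of_real (pi * \<alpha>)) *
          (\<Sum>k. (-1) ^ k * (of_real \<alpha> gchoose k) * f (s + of_real (real k * h)))
          / of_real (h powr \<alpha>))"

definition eta_deriv :: "real \<Rightarrow> complex \<Rightarrow> complex" where
  "eta_deriv \<alpha> = rev_GL_deriv \<alpha> dirichlet_eta"

definition qM :: "nat \<Rightarrow> real" where
  "qM M = ln (ln (real M) / ln (real (M + 1))) / ln (real M / real (M + 1))"

end

theory Submission
  imports Defs "HOL-Real_Asymp.Real_Asymp"
begin

text \<open>
  In each of the regions a single term of the series of the fractional derivative is larger in absolute
  value than all other terms together, so the series cannot vanish.

  All regions lie in the half-plane \<open>Re s > 1\<close>, because \<open>qM M\<close> is nonnegative and the admissible
  \<open>u\<close> are at least 1.1 (\<open>gap_parameter_ge\<close>). There the eta series converges absolutely. The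
  Gruenwald-Letnikov difference of order \<open>\<alpha>\<close> multiplies the term \<open>n powr - s\<close> by
  \<open>(1 - n powr - h) powr \<alpha>\<close>, by the binomial series, and two applications of dominated convergence
  identify the derivative with the series whose terms have absolute value
  \<open>f n = (ln n) powr \<alpha> * n powr - \<sigma>\<close>, where \<open>\<sigma> = Re s\<close> (\<open>eta_deriv_series\<close>).

  The quotients of consecutive terms are
  \<open>f (n + 1) / f n = (n / (n + 1)) powr (\<sigma> - qM n * \<alpha>)\<close>, and \<open>qM\<close> decreases by concavity of the
  logarithm. Hence if \<open>\<sigma>\<close> lies between \<open>qM M * \<alpha>\<close> and \<open>qM (M - 1) * \<alpha>\<close>, then the terms increase
  up to \<open>n = M\<close> and decrease afterwards, and the distances of \<open>\<sigma>\<close> from the two bounds control the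
  speed: \<open>f n \<le> f M * (M / n) powr p\<close> above \<open>M\<close> (\<open>eta_weight_le_above\<close>) and
  \<open>f n \<le> f M * (n / M) powr p\<close> below \<open>M\<close> (\<open>eta_weight_le_below\<close>). The terms above \<open>M\<close> are summed
  by comparison with an integral (\<open>eta_weight_tail_le\<close>), those below \<open>M\<close> by comparison with a
  geometric series (\<open>eta_weight_sum_below_less\<close>). It then remains to check that the sum of the
  bounds is smaller than 1, numerically for \<open>M = 2\<close> and \<open>M = 3\<close>, and through the condition on \<open>u\<close>
  for \<open>M > 3\<close>.
\<close>

section \<open>Binomial series on the closed unit interval\<close>

lemma gbinomial_bound:
  fixes a :: real
  obtains K where "\<And>n. n > 0 \<Longrightarrow> \<bar>a gchoose n\<bar> \<le> K * real n powr (- (a + 1))"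
proof -
  have "Bseq (\<lambda>n. (a gchoose n) / ((-1) ^ n / exp ((a + 1) * of_real (ln (real n)))))"
    by (intro convergent_imp_Bseq convergentI) (rule gbinomial_asymptotic)
  then obtain K where K: "\<And>n. norm ((a gchoose n) / ((-1) ^ n / exp ((a + 1) * of_real (ln (real n))))) \<le> K"
    by (elim BseqE) blast
  have "\<bar>a gchoose n\<bar> \<le> K * real n powr (- (a + 1))" if "n > 0" for n
  proof -
    have "\<bar>a gchoose n\<bar> * real n powr (a + 1) \<le> K"
      using K[of n] that by (simp add: powr_def abs_mult power_abs)
    then show ?thesis
      using that by (simp only: powr_minus flip: divide_inverse) (simp add: pos_le_divide_eq)
  qed
  then show ?thesis by (rule that)
qed

lemma summable_abs_gbinomial:
  fixes a :: real
  assumes "a > 0"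
  shows "summable (\<lambda>n. \<bar>a gchoose n\<bar>)"
proof -
  obtain K where K: "\<And>n. n > 0 \<Longrightarrow> \<bar>a gchoose n\<bar> \<le> K * real n powr (- (a + 1))"
    by (rule gbinomial_bound[of a]) blast
  have "summable (\<lambda>n. K * real n powr (- (a + 1)))"
    using assms by (intro summable_mult) (simp add: summable_real_powr_iff)
  then show ?thesis
    by (rule summable_comparison_test[rotated]) (use K in \<open>auto intro!: exI[of _ 1]\<close>)
qed

text \<open>
  The partial sums telescope to \<open>\<plusminus> (a - 1 gchoose n)\<close>, which is of order \<open>n powr - a\<close>.
  This is the binomial series at the boundary point of its disc of convergence; it is what makes
  the constant term \<open>n = 1\<close> of the eta series disappear under differentiation.
\<close>
lemma gbinomial_sums_zero:
  fixes a :: real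
  assumes "a > 0"
  shows "(\<lambda>k. (-1) ^ k * (a gchoose k)) sums 0"
proof -
  obtain K where K: "\<And>n. n > 0 \<Longrightarrow> \<bar>(a - 1) gchoose n\<bar> \<le> K * real n powr (- (a - 1 + 1))"
    by (rule gbinomial_bound[of "a - 1"]) blast
  have "(\<lambda>n. K * real n powr (- a)) \<longlonglongrightarrow> 0"
    using assms by real_asymp
  then have "(\<lambda>n. (-1) ^ n * ((a - 1) gchoose n)) \<longlonglongrightarrow> 0"
  proof (rule tendsto_0_le[where K = 1])
    have "norm ((-1) ^ n * ((a - 1) gchoose n)) \<le> norm (K * real n powr (- a)) * 1" if "1 \<le> n" for n
      using order_trans[OF K[of n] abs_ge_self] that by (simp add: abs_mult)
    then show "\<forall>\<^sub>F n in sequentially. norm ((-1) ^ n * ((a - 1) gchoose n)) \<le> norm (K * real n powr (- a)) * 1"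
      by (rule eventually_sequentiallyI)
  qed
  then show ?thesis
    using gbinomial_sum_lower_neg[of a] unfolding sums_def_le by (simp add: mult.commute)
qed

lemma gbinomial_sums_powr:
  fixes a x :: real
  assumes "a > 0" "0 \<le> x" "x \<le> 1"
  shows "(\<lambda>k. (-1) ^ k * (a gchoose k) * x ^ k) sums (1 - x) powr a"
proof (cases "x = 1")
  case True
  then show ?thesis using gbinomial_sums_zero[OF assms(1)] by simp
next
  case False
  then have "(\<lambda>k. (a gchoose k) * (-x) ^ k) sums (1 + - x) powr a"
    using assms by (intro gen_binomial_real) auto
  moreover have "(a gchoose k) * (-x) ^ k = (-1) ^ k * (a gchoose k) * x ^ k" for k
    by (subst power_minus) simp
  ultimately show ?thesis by simp
qed

section \<open>The fractional derivative as a Dirichlet series\<close>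

text \<open>
  Dominated convergence for series. It is used twice: once to interchange the binomial sum with the
  sum over \<open>n\<close>, and once to let the step size tend to zero.
\<close>
lemma tannery_suminf:
  fixes a :: "nat \<Rightarrow> 'b \<Rightarrow> complex"
  assumes "\<And>k. ((\<lambda>n. a k n) \<longlongrightarrow> b k) F"
    and "eventually (\<lambda>n. \<forall>k. norm (a k n) \<le> M k) F"
    and "summable M" "F \<noteq> bot"
  shows "((\<lambda>n. \<Sum>k. a k n) \<longlongrightarrow> (\<Sum>k. b k)) F"
proof -
  have "eventually (\<lambda>(k, n). norm (a k n) \<le> M k) (at_top \<times>\<^sub>F F)"
    using assms(2) unfolding eventually_prod_filter
    by (intro exI[of _ "\<lambda>_. True"] exI[of _ "\<lambda>n. \<forall>k. norm (a k n) \<le> M k"]) auto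
  from tannerys_theorem[OF assms(1) this assms(3,4)] show ?thesis by blast
qed

lemma norm_eta_term:
  "norm ((-1) ^ n / of_nat (Suc n) powr s :: complex) = real (Suc n) powr (- Re s)"
proof -
  have "norm (of_nat (Suc n) powr s :: complex) = real (Suc n) powr Re s"
    by (subst norm_powr_real_powr) auto
  then show ?thesis by (simp add: norm_divide norm_power powr_minus field_simps)
qed

lemma summable_Suc_powr:
  "p > 1 \<Longrightarrow> summable (\<lambda>n. real (Suc n) powr (- p))"
  by (subst summable_Suc_iff) (simp add: summable_real_powr_iff)

lemma Suc_powr_minus_le_1: "h > 0 \<Longrightarrow> real (Suc n) powr (- h) \<le> 1"
  using powr_mono[of "- h" 0 "real (Suc n)"] by simp

text \<open>
  A shift of the argument by \<open>k * h\<close> multiplies each term of a Dirichlet series by the \<open>k\<close>-th power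
  of a fixed number in \<open>(0, 1]\<close>, so the Gruenwald-Letnikov sum acts on each term as a
  binomial series.
\<close>
lemma of_nat_Suc_powr_shift:
  "(1::complex) / of_nat (Suc n) powr (s + of_real (real k * h)) =
    (1 / of_nat (Suc n) powr s) * of_real ((real (Suc n) powr (- h)) ^ k :: real)"
proof -
  have "of_nat (Suc n) powr (of_real (real k * h)) = complex_of_real (real (Suc n) powr (real k * h))"
    using powr_of_real[of "real (Suc n)" "real k * h"] by simp
  also have "real (Suc n) powr (real k * h) = 1 / (real (Suc n) powr (- h)) ^ k"
  proof -
    have "(real (Suc n) powr (- h)) ^ k = real (Suc n) powr (- (real k * h))"
      by (subst powr_realpow[symmetric]) (simp_all add: powr_powr mult.commute)
    then show ?thesis
      by (simp only: powr_minus divide_inverse inverse_inverse_eq mult_1_left)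
  qed
  finally show ?thesis
    by (simp add: powr_add)
qed

lemma of_real_gbinomial: "(of_real a gchoose k :: complex) = of_real (a gchoose k)"
  by (simp add: gbinomial_prod_rev)

text \<open>
  The partial sums over \<open>k\<close> are finite, so they can be moved inside the sum over \<open>n\<close>. There they
  are bounded uniformly in \<open>n\<close> by the absolutely convergent sum of the binomial coefficients, and they
  converge termwise to the value of the binomial series; dominated convergence in the number of
  partial summands gives the claim.
\<close>
lemma rev_GL_sum_eta:
  assumes "\<alpha> > 0" "h > 0" "Re s > 1"
  shows "(\<lambda>k. (-1) ^ k * (of_real \<alpha> gchoose k) * dirichlet_eta (s + of_real (real k * h))) sums
    (\<Sum>n. (-1) ^ n / of_nat (Suc n) powr s * of_real ((1 - real (Suc n) powr (- h)) powr \<alpha>))"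
proof -
  define c where "c n = ((-1) ^ n / of_nat (Suc n) powr s :: complex)" for n :: nat
  define x where "x n = real (Suc n) powr (- h)" for n :: nat
  define b where "b k = (-1) ^ k * (\<alpha> gchoose k)" for k
  have x: "0 \<le> x n" "x n \<le> 1" for n
    using Suc_powr_minus_le_1[OF assms(2)] by (auto simp: x_def)
  have b_summable: "summable (\<lambda>k. \<bar>b k\<bar>)"
    using summable_abs_gbinomial[OF assms(1)] by (simp add: b_def abs_mult)
  define B where "B = (\<Sum>k. \<bar>b k\<bar>)"
  have c_summable: "summable (\<lambda>n. norm (c n))"
    unfolding c_def norm_eta_term by (rule summable_Suc_powr) (use assms in auto)
  have bound: "\<bar>\<Sum>k<K. b k * x n ^ k\<bar> \<le> B" for K n
  proof -
    have "\<bar>\<Sum>k<K. b k * x n ^ k\<bar> \<le> (\<Sum>k<K. \<bar>b k\<bar>)"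
      by (intro sum_norm_le[of _ "\<lambda>k. b k * x n ^ k", simplified] ballI)
         (use x[of n] in \<open>auto simp: abs_mult intro!: mult_left_le power_le_one\<close>)
    also have "\<dots> \<le> B"
      unfolding B_def by (rule sum_le_suminf[OF b_summable]) auto
    finally show ?thesis .
  qed
  have "((\<lambda>K. \<Sum>n. c n * of_real (\<Sum>k<K. b k * x n ^ k)) \<longlongrightarrow>
    (\<Sum>n. c n * of_real ((1 - x n) powr \<alpha>))) sequentially"
  proof (rule tannery_suminf[where M = "\<lambda>n. norm (c n) * B"])
    show "(\<lambda>K. c n * of_real (\<Sum>k<K. b k * x n ^ k)) \<longlonglongrightarrow> c n * of_real ((1 - x n) powr \<alpha>)" for n
      using gbinomial_sums_powr[OF assms(1) x]
      by (intro tendsto_intros) (simp add: sums_def b_def)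
    show "\<forall>\<^sub>F K in sequentially. \<forall>n. cmod (c n * of_real (\<Sum>k<K. b k * x n ^ k)) \<le> cmod (c n) * B"
      unfolding norm_mult norm_of_real
      by (intro always_eventually allI mult_left_mono bound) auto
  qed (use c_summable in \<open>auto intro: summable_mult2\<close>)
  moreover have "(\<Sum>n. c n * of_real (\<Sum>k<K. b k * x n ^ k)) =
    (\<Sum>k<K. (-1) ^ k * (of_real \<alpha> gchoose k) * dirichlet_eta (s + of_real (real k * h)))" for K
  proof -
    have shift: "(-1) ^ n / of_nat (Suc n) powr (s + of_real (real k * h)) = c n * of_real (x n ^ k)" for n k
      using of_nat_Suc_powr_shift[of n s k h]
      by (simp add: c_def x_def divide_inverse)
    have sm: "summable (\<lambda>n. c n * of_real (x n ^ k))" for k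
    proof (rule summable_norm_cancel, rule summable_comparison_test'[OF c_summable])
      show "norm (norm (c n * of_real (x n ^ k))) \<le> norm (c n)" for n
        using x[of n] by (auto simp: norm_mult norm_power intro!: mult_left_le power_le_one)
    qed
    have "(\<Sum>n. c n * of_real (\<Sum>k<K. b k * x n ^ k)) =
      (\<Sum>n. \<Sum>k<K. of_real (b k) * (c n * of_real (x n ^ k)))"
      by (simp add: sum_distrib_left mult_ac)
    also have "\<dots> = (\<Sum>k<K. \<Sum>n. of_real (b k) * (c n * of_real (x n ^ k)))"
      by (intro suminf_sum summable_mult sm)
    also have "\<dots> = (\<Sum>k<K. of_real (b k) * (\<Sum>n. c n * of_real (x n ^ k)))"
      by (intro sum.cong refl suminf_mult sm)
    also have "\<dots> = (\<Sum>k<K. (-1) ^ k * (of_real \<alpha> gchoose k) * dirichlet_eta (s + of_real (real k * h)))"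
      unfolding dirichlet_eta_def shift by (simp add: b_def of_real_gbinomial)
    finally show ?thesis .
  qed
  ultimately show ?thesis
    unfolding sums_def by (simp add: c_def x_def)
qed

lemma summable_ln_powr:
  assumes "p > 1"
  shows "summable (\<lambda>n. ln (real (Suc n)) powr a * real (Suc n) powr (- p))"
proof (rule summable_comparison_test_bigo)
  show "summable (\<lambda>n. norm (real (Suc n) powr (- ((1 + p) / 2))))"
    using summable_Suc_powr[of "(1 + p) / 2"] assms by simp
  show "(\<lambda>n. ln (real (Suc n)) powr a * real (Suc n) powr (- p)) \<in> O(\<lambda>n. real (Suc n) powr (- ((1 + p) / 2)))"
    using assms by real_asymp
qed

text \<open>
  Since \<open>(1 - N powr - h) / h\<close> increases to \<open>ln N\<close> as \<open>h\<close> decreases to zero, the terms of the series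
  produced by \<open>rev_GL_sum_eta\<close>, divided by \<open>h powr \<alpha>\<close>, are dominated by those of the limit series.
\<close>
lemma eta_deriv_series:
  assumes "\<alpha> > 0" "Re s > 1"
  shows "eta_deriv \<alpha> s = exp (\<i> * of_real (pi * \<alpha>)) *
    (\<Sum>n. (-1) ^ n / of_nat (Suc n) powr s * of_real (ln (real (Suc n)) powr \<alpha>))"
proof -
  define c where "c n = ((-1) ^ n / of_nat (Suc n) powr s :: complex)" for n :: nat
  define d where "d h n = ((1 - real (Suc n) powr (- h)) / h) powr \<alpha>" for h and n :: nat
  have lim: "((\<lambda>h. \<Sum>n. c n * of_real (d h n)) \<longlongrightarrow> (\<Sum>n. c n * of_real (ln (real (Suc n)) powr \<alpha>))) (at_right 0)"
  proof (rule tannery_suminf[where M = "\<lambda>n. ln (real (Suc n)) powr \<alpha> * real (Suc n) powr (- Re s)"])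
    fix n :: nat
    show "((\<lambda>h. c n * of_real (d h n)) \<longlongrightarrow> c n * of_real (ln (real (Suc n)) powr \<alpha>)) (at_right 0)"
    \<comment> \<open>The term \<open>n = 0\<close> is constantly zero. In all others the base of the power has a positive limit,
      so that the power is continuous there.\<close>
    proof (cases "n = 0")
      case False
      have "((\<lambda>h. real (Suc n) powr (- h)) has_real_derivative - ln (real (Suc n))) (at 0)"
        by (auto intro!: derivative_eq_intros)
      then have "((\<lambda>h. (1 - real (Suc n) powr (- h)) / h) \<longlongrightarrow> ln (real (Suc n))) (at 0)"
        unfolding has_field_derivative_iff by (auto dest: tendsto_minus simp: minus_divide_left)
      then have "((\<lambda>h. (1 - real (Suc n) powr (- h)) / h) \<longlongrightarrow> ln (real (Suc n))) (at_right 0)"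
        by (rule filterlim_mono) (simp_all add: at_le)
      then show ?thesis
        unfolding d_def using False by (intro tendsto_intros) auto
    qed (simp add: d_def)
  next
    have "norm (c n * of_real (d h n)) \<le> ln (real (Suc n)) powr \<alpha> * real (Suc n) powr (- Re s)"
      if "h > 0" for h and n :: nat
    proof -
      have "1 + (- (h * ln (real (Suc n)))) \<le> exp (- (h * ln (real (Suc n))))"
        by (rule exp_ge_add_one_self)
      then have "(1 - real (Suc n) powr (- h)) / h \<le> ln (real (Suc n))"
        using that by (simp add: powr_def field_simps)
      moreover have "0 \<le> (1 - real (Suc n) powr (- h)) / h"
        using that Suc_powr_minus_le_1[OF that, of n] by (intro divide_nonneg_pos) linarith+
      ultimately have "d h n \<le> ln (real (Suc n)) powr \<alpha>"
        unfolding d_def using assms by (intro powr_mono2) auto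
      then have "d h n * real (Suc n) powr (- Re s) \<le> ln (real (Suc n)) powr \<alpha> * real (Suc n) powr (- Re s)"
        by (intro mult_right_mono) auto
      then show ?thesis
        unfolding norm_mult norm_of_real c_def norm_eta_term by (simp add: mult.commute d_def)
    qed
    then show "\<forall>\<^sub>F h in at_right 0. \<forall>n. norm (c n * of_real (d h n)) \<le> ln (real (Suc n)) powr \<alpha> * real (Suc n) powr (- Re s)"
      by (intro eventually_mono[OF eventually_at_right_less[of 0]] allI)
  qed (rule summable_ln_powr[OF assms(2)], simp)
  have "((\<lambda>h. exp (\<i> * of_real (pi * \<alpha>)) *
          (\<Sum>k. (-1) ^ k * (of_real \<alpha> gchoose k) * dirichlet_eta (s + of_real (real k * h)))
          / of_real (h powr \<alpha>)) \<longlongrightarrow>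
        exp (\<i> * of_real (pi * \<alpha>)) * (\<Sum>n. c n * of_real (ln (real (Suc n)) powr \<alpha>))) (at_right 0)"
  proof (rule Lim_transform_eventually[OF tendsto_mult_left[OF lim]])
    have "exp (\<i> * of_real (pi * \<alpha>)) * (\<Sum>n. c n * of_real (d h n)) =
        exp (\<i> * of_real (pi * \<alpha>)) *
          (\<Sum>k. (-1) ^ k * (of_real \<alpha> gchoose k) * dirichlet_eta (s + of_real (real k * h)))
          / of_real (h powr \<alpha>)" if "h > 0" for h
    proof -
      have "c n * of_real (d h n) =
        c n * of_real ((1 - real (Suc n) powr (- h)) powr \<alpha>) / of_real (h powr \<alpha>)" for n
        using that by (simp add: d_def powr_divide)
      moreover have "summable (\<lambda>n. c n * of_real ((1 - real (Suc n) powr (- h)) powr \<alpha>))"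
      proof (rule summable_norm_cancel, rule summable_comparison_test'[of "\<lambda>n. norm (c n)"])
        show "summable (\<lambda>n. norm (c n))"
          unfolding c_def norm_eta_term by (rule summable_Suc_powr) (use assms in auto)
        have "0 \<le> 1 - real (Suc n) powr (- h)" "1 - real (Suc n) powr (- h) \<le> 1" for n
          using Suc_powr_minus_le_1[OF that, of n] by simp_all
        then show "norm (norm (c n * of_real ((1 - real (Suc n) powr (- h)) powr \<alpha>))) \<le> norm (c n)" for n
          using assms by (auto simp: norm_mult intro!: mult_left_le powr_le1)
      qed
      ultimately have "(\<Sum>n. c n * of_real (d h n)) =
        (\<Sum>n. c n * of_real ((1 - real (Suc n) powr (- h)) powr \<alpha>)) / of_real (h powr \<alpha>)"
        by (simp only: suminf_divide)
      then show ?thesis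
        using sums_unique[OF rev_GL_sum_eta[OF assms(1) that assms(2)]]
        by (simp only: c_def times_divide_eq_right)
    qed
    then show "\<forall>\<^sub>F h in at_right 0. exp (\<i> * of_real (pi * \<alpha>)) * (\<Sum>n. c n * of_real (d h n)) =
        exp (\<i> * of_real (pi * \<alpha>)) *
          (\<Sum>k. (-1) ^ k * (of_real \<alpha> gchoose k) * dirichlet_eta (s + of_real (real k * h)))
          / of_real (h powr \<alpha>)"
      by (rule eventually_mono[OF eventually_at_right_less[of 0]])
  qed
  then show ?thesis
    unfolding eta_deriv_def rev_GL_deriv_def c_def by (intro tendsto_Lim) auto
qed

section \<open>A dominant term forces the derivative to be nonzero\<close>

text \<open>
  The absolute value of the term with the factor \<open>n powr - s\<close> in the series of the fractional
  derivative, where \<open>\<sigma> = Re s\<close>.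
\<close>
definition eta_weight :: "real \<Rightarrow> real \<Rightarrow> nat \<Rightarrow> real" where
  "eta_weight \<alpha> \<sigma> n = ln (real n) powr \<alpha> * real n powr (- \<sigma>)"

lemma eta_weight_nonneg: "eta_weight \<alpha> \<sigma> n \<ge> 0"
  by (simp add: eta_weight_def)

lemma eta_weight_pos: "n \<ge> 2 \<Longrightarrow> eta_weight \<alpha> \<sigma> n > 0"
  by (simp add: eta_weight_def)

lemma summable_eta_weight:
  assumes "\<sigma> > 1"
  shows "summable (\<lambda>k. eta_weight \<alpha> \<sigma> (k + N))"
proof -
  have "summable (\<lambda>n. eta_weight \<alpha> \<sigma> (Suc n))"
    using summable_ln_powr[OF assms, of \<alpha>] by (simp only: eta_weight_def)
  then show ?thesis
    by (simp only: summable_Suc_iff summable_iff_shift)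
qed

lemma eta_deriv_nonzero_if_dominant:
  assumes "\<alpha> > 0" "Re s > 1" "M \<ge> 2"
    and dom: "(\<Sum>n = 2..<M. eta_weight \<alpha> (Re s) n) + (\<Sum>k. eta_weight \<alpha> (Re s) (k + Suc M))
      < eta_weight \<alpha> (Re s) M"
  shows "eta_deriv \<alpha> s \<noteq> 0"
proof
  assume zero: "eta_deriv \<alpha> s = 0"
  define a where "a n = ((-1) ^ n / of_nat (Suc n) powr s * of_real (ln (real (Suc n)) powr \<alpha>) :: complex)" for n
  let ?f = "eta_weight \<alpha> (Re s)"
  have norm_a: "norm (a n) = ?f (Suc n)" for n
    unfolding a_def norm_mult norm_eta_term eta_weight_def by simp
  have summ: "summable (\<lambda>n. norm (a n))"
    unfolding norm_a using summable_eta_weight[OF assms(2), of \<alpha> 1] by simp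
  obtain m where M: "M = Suc m" and m: "m \<ge> 1"
    using assms(3) by (cases M) auto
  have "suminf a = 0"
    using zero eta_deriv_series[OF assms(1,2)] by (simp add: a_def[abs_def])
  then have "(\<Sum>n. a (n + M)) + (\<Sum>n<m. a n) + a m = 0"
    using suminf_split_initial_segment[OF summable_norm_cancel[OF summ], of M] M by (simp add: add.assoc)
  then have "a m = - ((\<Sum>n. a (n + M)) + (\<Sum>n<m. a n))"
    by (metis add_eq_0_iff)
  then have "norm (a m) \<le> norm (\<Sum>n. a (n + M)) + norm (\<Sum>n<m. a n)"
    by (metis norm_minus_cancel norm_triangle_ineq)
  also have "norm (\<Sum>n. a (n + M)) \<le> (\<Sum>n. norm (a (n + M)))"
    by (rule summable_norm[OF summable_ignore_initial_segment[OF summ]])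
  also have "norm (\<Sum>n<m. a n) \<le> (\<Sum>n<m. ?f (Suc n))"
    by (rule sum_norm_le) (simp add: norm_a)
  also have "(\<Sum>n<m. ?f (Suc n)) = (\<Sum>n = 1..<M. ?f n)"
    using sum.shift_bounds_Suc_ivl[of ?f 0 m] by (simp add: M atLeast0LessThan)
  \<comment> \<open>The term \<open>n = 1\<close> vanishes because \<open>ln 1 = 0\<close>.\<close>
  also have "\<dots> = (\<Sum>n = 2..<M. ?f n)"
    using m assms(1) unfolding M by (subst sum.atLeast_Suc_lessThan) (auto simp: eta_weight_def numeral_2_eq_2)
  finally show False
    using dom unfolding norm_a M by simp
qed

section \<open>Size of the terms relative to a fixed one\<close>

text \<open>
  In the variable \<open>x = ln n\<close> the number \<open>qM M\<close> is the slope of the secant of the logarithm between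
  \<open>ln M\<close> and \<open>ln (M + 1)\<close>.
\<close>
lemma qM_mult_ln:
  assumes "M \<ge> 2"
  shows "qM M * (ln (real (Suc M)) - ln (real M)) = ln (ln (real (Suc M))) - ln (ln (real M))"
proof -
  have "ln (real M) < ln (real (Suc M))" "ln (real M) > 0"
    using assms by auto
  then show ?thesis
    using assms unfolding qM_def by (simp add: ln_div field_simps)
qed

text \<open>
  The logarithm is concave, so consecutive secant slopes decrease: both are compared with the slope
  \<open>1 / b\<close> of the tangent at their common point \<open>b\<close>.
\<close>
lemma qM_Suc_le:
  assumes "M \<ge> 2"
  shows "qM (Suc M) \<le> qM M"
proof -
  define a b c where "a = ln (real M)" "b = ln (real (Suc M))" "c = ln (real (Suc (Suc M)))"
  have abc: "0 < a" "a < b" "b < c"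
    using assms by (auto simp: a_b_c_def)
  have "ln (a / b) \<le> a / b - 1" "ln (c / b) \<le> c / b - 1"
    using abc by (auto intro!: ln_le_minus_one)
  then have "ln a - ln b \<le> (a - b) / b" "ln c - ln b \<le> (c - b) / b"
    using abc by (simp_all add: ln_div diff_divide_distrib)
  moreover have "qM M * (b - a) = ln b - ln a" "qM (Suc M) * (c - b) = ln c - ln b"
    using qM_mult_ln[of M] qM_mult_ln[of "Suc M"] assms by (auto simp: a_b_c_def)
  ultimately have "(1 / b) * (b - a) \<le> qM M * (b - a)" "qM (Suc M) * (c - b) \<le> (1 / b) * (c - b)"
    by (simp_all add: diff_divide_distrib)
  then have "1 / b \<le> qM M" "qM (Suc M) \<le> 1 / b"
    using abc by (auto dest: mult_right_le_imp_le simp del: times_divide_eq_left mult_le_cancel_right)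
  then show ?thesis by simp
qed

lemma qM_antimono:
  assumes "2 \<le> M" "M \<le> n"
  shows "qM n \<le> qM M"
  using assms(2) by (induction n rule: dec_induct) (use assms(1) qM_Suc_le in \<open>auto intro: order_trans\<close>)

lemma qM_nonneg:
  assumes "M \<ge> 2"
  shows "qM M \<ge> 0"
proof -
  have "ln (real M) < ln (real (Suc M))" "0 < ln (real M)"
    using assms by auto
  then have "0 < qM M * (ln (real (Suc M)) - ln (real M))"
    unfolding qM_mult_ln[OF assms] diff_gt_0_iff_gt by (subst ln_less_cancel_iff) linarith+
  with \<open>ln (real M) < ln (real (Suc M))\<close> show ?thesis
    by (simp add: zero_less_mult_iff)
qed

text \<open>
  Consecutive terms are equal exactly at \<open>\<sigma> = qM n * \<alpha>\<close>. The distance of \<open>\<sigma>\<close> from this value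
  measures the growth or decay from \<open>n\<close> to \<open>n + 1\<close>.
\<close>
lemma eta_weight_Suc:
  assumes "n \<ge> 2"
  shows "eta_weight \<alpha> \<sigma> (Suc n) = eta_weight \<alpha> \<sigma> n * (real n / real (Suc n)) powr (\<sigma> - qM n * \<alpha>)"
proof -
  have weight: "eta_weight \<alpha> \<sigma> m = exp (\<alpha> * ln (ln (real m)) - \<sigma> * ln (real m))" if "m \<ge> 2" for m
    using that by (simp add: eta_weight_def powr_def exp_diff exp_minus divide_inverse)
  have "(\<sigma> - qM n * \<alpha>) * (ln (real n) - ln (real (Suc n))) =
      - \<sigma> * (ln (real (Suc n)) - ln (real n)) + \<alpha> * (qM n * (ln (real (Suc n)) - ln (real n)))"
    by (simp add: algebra_simps)
  also have "\<dots> = (\<alpha> * ln (ln (real (Suc n))) - \<sigma> * ln (real (Suc n))) - (\<alpha> * ln (ln (real n)) - \<sigma> * ln (real n))"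
    unfolding qM_mult_ln[OF assms] by (simp add: algebra_simps)
  moreover have "(real n / real (Suc n)) powr (\<sigma> - qM n * \<alpha>) = exp ((\<sigma> - qM n * \<alpha>) * (ln (real n) - ln (real (Suc n))))"
    using assms by (simp add: powr_def ln_div)
  ultimately show ?thesis
    using weight[of n] weight[of "Suc n"] assms by (simp flip: exp_add)
qed

text \<open>
  As \<open>qM\<close> decreases, a decay of order \<open>p\<close> in the step after \<open>M\<close> persists in all later steps, and
  the quotients telescope.
\<close>
lemma eta_weight_le_above:
  assumes "2 \<le> M" "M \<le> n" "\<alpha> \<ge> 0" "p \<le> \<sigma> - qM M * \<alpha>"
  shows "eta_weight \<alpha> \<sigma> n \<le> eta_weight \<alpha> \<sigma> M * (real M / real n) powr p"
  using assms(2)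
proof (induction n rule: dec_induct)
  case base
  then show ?case using assms(1) by simp
next
  case (step n)
  have "qM n * \<alpha> \<le> qM M * \<alpha>"
    using qM_antimono[OF assms(1) step(1)] assms(3) by (rule mult_right_mono)
  then have le: "(real n / real (Suc n)) powr (\<sigma> - qM n * \<alpha>) \<le> (real n / real (Suc n)) powr p"
    using assms(1,4) step(1) by (intro powr_mono') auto
  have "eta_weight \<alpha> \<sigma> (Suc n) \<le>
      (eta_weight \<alpha> \<sigma> M * (real M / real n) powr p) * (real n / real (Suc n)) powr p"
    using assms(1) step eta_weight_Suc[of n \<alpha> \<sigma>] eta_weight_nonneg
    by (auto intro!: mult_mono step.IH le simp del: of_nat_Suc)
  also have "\<dots> = eta_weight \<alpha> \<sigma> M * (real M / real (Suc n)) powr p"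
    using assms(1) step(1) by (simp add: powr_mult[symmetric] mult.assoc del: of_nat_Suc)
  finally show ?case .
qed

text \<open>
  The mirror image of the previous estimate: growth of order \<open>p\<close> in the step before \<open>M\<close> is
  at least matched in all earlier steps.
\<close>
lemma eta_weight_le_below:
  assumes "2 \<le> n" "n \<le> M" "\<alpha> \<ge> 0" "p \<le> qM (M - 1) * \<alpha> - \<sigma>"
  shows "eta_weight \<alpha> \<sigma> n \<le> eta_weight \<alpha> \<sigma> M * (real n / real M) powr p"
  using assms(2)
proof (induction n rule: inc_induct)
  case base
  then show ?case using assms(1,2) by simp
next
  case (step k)
  have k: "k \<ge> 2" "k \<le> M - 1" using step assms(1) by auto
  have "qM (M - 1) * \<alpha> \<le> qM k * \<alpha>"
    using qM_antimono[OF k] assms(3) by (rule mult_right_mono)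
  then have le: "(real k / real (Suc k)) powr (qM k * \<alpha> - \<sigma>) \<le> (real k / real (Suc k)) powr p"
    using assms(4) k by (intro powr_mono') auto
  have "eta_weight \<alpha> \<sigma> k = eta_weight \<alpha> \<sigma> (Suc k) * (real k / real (Suc k)) powr (qM k * \<alpha> - \<sigma>)"
    using k unfolding eta_weight_Suc[OF k(1)] by (simp add: mult.assoc flip: powr_add)
  also have "\<dots> \<le> (eta_weight \<alpha> \<sigma> M * (real (Suc k) / real M) powr p) * (real k / real (Suc k)) powr p"
    using eta_weight_nonneg by (auto intro!: mult_mono step.IH le simp del: of_nat_Suc)
  also have "\<dots> = eta_weight \<alpha> \<sigma> M * (real k / real M) powr p"
    using k step by (simp add: powr_mult[symmetric] mult.assoc del: of_nat_Suc)
  finally show ?case .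
qed

section \<open>Sums over the two sides of the dominant term\<close>

text \<open>
  The right-hand side is the integral of \<open>t powr - p\<close> over \<open>[x - 1, x]\<close>. After division by
  \<open>x powr (1 - p)\<close> the claim is the Bernoulli inequality \<open>y powr (1 - p) \<ge> 1 + (p - 1) / x\<close> for
  \<open>y = 1 - 1 / x\<close>, which follows from \<open>ln y \<le> y - 1\<close>.
\<close>
lemma powr_le_integral_diff:
  fixes x p :: real
  assumes "x > 1" "p > 1"
  shows "x powr (- p) \<le> ((x - 1) powr (1 - p) - x powr (1 - p)) / (p - 1)"
proof -
  define y where "y = 1 - 1 / x"
  have y: "0 < y" using assms by (simp add: y_def)
  have "ln y \<le> - (1 / x)"
    using ln_le_minus_one[OF y] by (simp add: y_def)
  then have "(p - 1) * (1 / x) \<le> (1 - p) * ln y"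
    using mult_left_mono[of "ln y" "- (1 / x)" "p - 1"] assms by (simp add: algebra_simps)
  then have "1 + (p - 1) * (1 / x) \<le> 1 + (1 - p) * ln y"
    by simp
  also have "\<dots> \<le> exp ((1 - p) * ln y)"
    by (rule exp_ge_add_one_self)
  also have "\<dots> = y powr (1 - p)"
    using y by (simp add: powr_def)
  finally have "1 + (p - 1) * (1 / x) \<le> y powr (1 - p)" .
  then have "x powr (1 - p) * (1 + (p - 1) * (1 / x)) \<le> x powr (1 - p) * y powr (1 - p)"
    by (rule mult_left_mono) simp
  also have "x powr (1 - p) * y powr (1 - p) = (x - 1) powr (1 - p)"
    using assms y by (simp add: powr_mult[symmetric] y_def algebra_simps)
  finally have "x powr (1 - p) + (p - 1) * (x powr (1 - p) * (1 / x)) \<le> (x - 1) powr (1 - p)"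
    by (simp add: algebra_simps)
  moreover have "x powr (1 - p) * (1 / x) = x powr (- p)"
    using assms by (simp add: powr_diff powr_minus divide_inverse)
  ultimately have "x powr (1 - p) + (p - 1) * x powr (- p) \<le> (x - 1) powr (1 - p)"
    by (simp only:)
  then show ?thesis
    using assms by (simp add: pos_le_divide_eq mult.commute)
qed

text \<open>
  The integral comparison is applied to all terms but the first, which is kept exactly.
\<close>
lemma powr_tail_le:
  fixes p :: real and N :: nat
  assumes "p > 1" "N \<ge> 1"
  shows "summable (\<lambda>k. real (k + N) powr (- p))"
    and "(\<Sum>k. real (k + N) powr (- p)) \<le> real N powr (- p) * (1 + real N / (p - 1))"
proof -
  define h where "h k = real (k + N) powr (- p)" for k
  define g where "g k = real (k + N) powr (1 - p) / (p - 1)" for k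
  show summ: "summable (\<lambda>k. real (k + N) powr (- p))"
    using summable_iff_shift[of "\<lambda>k. real k powr (- p)" N] assms by (simp add: summable_real_powr_iff)
  have h: "summable h" unfolding h_def by (rule summ)
  have step: "h (Suc k) \<le> g k - g (Suc k)" for k
    using powr_le_integral_diff[of "real (Suc k + N)" p] assms
    by (simp add: h_def g_def diff_divide_distrib)
  have "(\<Sum>k<K. h (Suc k)) \<le> g 0" for K
  proof -
    have "(\<Sum>k<K. h (Suc k)) \<le> (\<Sum>k<K. g k - g (Suc k))"
      by (intro sum_mono step)
    also have "\<dots> = g 0 - g K"
      by (rule sum_lessThan_telescope')
    also have "\<dots> \<le> g 0"
      using assms by (simp add: g_def)
    finally show ?thesis .
  qed
  then have "(\<Sum>k. h (Suc k)) \<le> g 0"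
    using h by (intro suminf_le_const) (simp_all add: summable_Suc_iff)
  then have "suminf h \<le> h 0 + g 0"
    using suminf_split_head[OF h] by simp
  also have "\<dots> = real N powr (- p) * (1 + real N / (p - 1))"
    using assms by (simp add: h_def g_def powr_diff powr_minus field_simps)
  finally show "(\<Sum>k. real (k + N) powr (- p)) \<le> real N powr (- p) * (1 + real N / (p - 1))"
    unfolding h_def .
qed

lemma eta_weight_tail_le:
  assumes "2 \<le> M" "M \<le> N" "\<alpha> \<ge> 0" "1 < p" "p \<le> \<sigma> - qM M * \<alpha>"
  shows "(\<Sum>k. eta_weight \<alpha> \<sigma> (k + N)) \<le>
    eta_weight \<alpha> \<sigma> M * ((real M / real N) powr p * (1 + real N / (p - 1)))"
proof -
  have "0 \<le> qM M * \<alpha>"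
    using qM_nonneg[OF assms(1)] assms(3) by simp
  then have "\<sigma> > 1" using assms by simp
  define C where "C = eta_weight \<alpha> \<sigma> M * real M powr p"
  have "(\<Sum>k. eta_weight \<alpha> \<sigma> (k + N)) \<le> (\<Sum>k. C * real (k + N) powr (- p))"
  proof (rule suminf_le)
    show "eta_weight \<alpha> \<sigma> (k + N) \<le> C * real (k + N) powr (- p)" for k
      using eta_weight_le_above[OF assms(1) _ assms(3,5), of "k + N"] assms(1,2)
      by (simp add: C_def powr_divide powr_minus_divide)
  qed (use \<open>\<sigma> > 1\<close> assms in \<open>auto intro!: summable_eta_weight summable_mult powr_tail_le simp del: summable_iff_shift of_nat_add\<close>)
  also have "\<dots> = C * (\<Sum>k. real (k + N) powr (- p))"
    using assms by (intro suminf_mult powr_tail_le) auto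
  also have "\<dots> \<le> C * (real N powr (- p) * (1 + real N / (p - 1)))"
    using assms by (intro mult_left_mono powr_tail_le) (auto simp: C_def eta_weight_nonneg)
  also have "\<dots> = eta_weight \<alpha> \<sigma> M * ((real M / real N) powr p * (1 + real N / (p - 1)))"
    by (simp add: C_def powr_divide powr_minus_divide)
  finally show ?thesis .
qed


lemma sum_power_below_lt_geometric:
  fixes r :: real
  assumes "0 < r" "r < 1"
  shows "(\<Sum>n = 2..<M. r ^ (M - n)) < r / (1 - r)"
proof -
  have "(\<Sum>n = 2..<M. r ^ (M - n)) \<le> (\<Sum>n<M. r ^ (M - n))"
    by (rule sum_mono2) (use assms in auto)
  also have "\<dots> = (\<Sum>n<M. r * r ^ (M - Suc n))"
    by (intro sum.cong refl) (simp add: Suc_diff_Suc flip: power_Suc)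
  also have "\<dots> = r * (\<Sum>n<M. r ^ n)"
    by (simp only: sum_distrib_left[symmetric] sum.nat_diff_reindex)
  also have "\<dots> = r * ((1 - r ^ M) / (1 - r))"
    using assms by (subst sum_gp_strict) auto
  also have "\<dots> < r / (1 - r)"
    using assms by (simp add: field_simps)
  finally show ?thesis .
qed

text \<open>
  The estimate \<open>(n / M) powr (M * u) \<le> exp (- u) ^ (M - n)\<close> turns the terms before the \<open>M\<close>-th into
  a finite piece of a geometric series; dropping the rest of that series makes the inequality strict.
\<close>
lemma eta_weight_sum_below_less:
  assumes "2 \<le> M" "\<alpha> \<ge> 0" "u > 0" "real M * u \<le> qM (M - 1) * \<alpha> - \<sigma>"
  shows "(\<Sum>n = 2..<M. eta_weight \<alpha> \<sigma> n) < eta_weight \<alpha> \<sigma> M * (1 / (exp u - 1))"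
proof -
  have "eta_weight \<alpha> \<sigma> n \<le> eta_weight \<alpha> \<sigma> M * exp (- u) ^ (M - n)" if "n \<in> {2..<M}" for n
  proof -
    have "real M * u * ln (real n / real M) \<le> real M * u * (real n / real M - 1)"
      using that assms by (intro mult_left_mono ln_le_minus_one) auto
    also have "\<dots> = real (M - n) * (- u)"
      using that by (simp add: of_nat_diff field_simps)
    finally have "(real n / real M) powr (real M * u) \<le> exp (- u) ^ (M - n)"
      using that assms by (simp add: powr_def flip: exp_of_nat_mult)
    then have "eta_weight \<alpha> \<sigma> M * (real n / real M) powr (real M * u) \<le> eta_weight \<alpha> \<sigma> M * exp (- u) ^ (M - n)"
      by (intro mult_left_mono eta_weight_nonneg)
    with eta_weight_le_below[of n M \<alpha> "real M * u" \<sigma>] that assms show ?thesis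
      by (auto intro: order_trans)
  qed
  then have "(\<Sum>n = 2..<M. eta_weight \<alpha> \<sigma> n) \<le> (\<Sum>n = 2..<M. eta_weight \<alpha> \<sigma> M * exp (- u) ^ (M - n))"
    by (rule sum_mono)
  also have "\<dots> = eta_weight \<alpha> \<sigma> M * (\<Sum>n = 2..<M. exp (- u) ^ (M - n))"
    by (simp add: sum_distrib_left)
  also have "\<dots> < eta_weight \<alpha> \<sigma> M * (exp (- u) / (1 - exp (- u)))"
    using assms by (intro mult_strict_left_mono sum_power_below_lt_geometric eta_weight_pos) auto
  also have "exp (- u) / (1 - exp (- u)) = 1 / (exp u - 1)"
    using assms by (simp add: exp_minus field_simps)
  finally show ?thesis .
qed

lemma ln_one_minus_le_quadratic:
  fixes x :: real
  assumes "0 \<le> x" "x < 1"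
  shows "ln (1 - x) \<le> - x - x\<^sup>2 / 2"
proof -
  let ?h = "\<lambda>t::real. ln (1 - t) + t + t\<^sup>2 / 2"
  have "?h x \<le> ?h 0"
  proof (rule DERIV_nonpos_imp_nonincreasing[OF assms(1)])
    fix t :: real
    assume t: "0 \<le> t" "t \<le> x"
    have "(?h has_real_derivative (- 1 / (1 - t) + 1 + t)) (at t)"
      using t assms by (auto intro!: derivative_eq_intros)
    moreover have "- 1 / (1 - t) + 1 + t \<le> 0"
      using t assms by (simp add: field_simps)
    ultimately show "\<exists>y. (?h has_real_derivative y) (at t) \<and> y \<le> 0"
      by blast
  qed
  then show ?thesis by simp
qed

text \<open>
  Replacing the power by \<open>exp (- u)\<close> alone is too crude, because the other factor exceeds
  \<open>1 + 1 / u\<close>. With \<open>x = 1 / (M + 1)\<close> the second-order term of \<open>ln (1 - x)\<close> yields an additional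
  factor \<open>exp (- u * x / 2)\<close>, while the excess of the other factor is
  \<open>1 + x / ((u - x) * (u + 1)) \<le> exp (u * x / 2)\<close> as soon as \<open>2 \<le> (u - x) * (u + 1) * u\<close>; the last
  condition holds in the stated range of \<open>u\<close> and \<open>M\<close>.
\<close>
lemma upper_tail_factor_le:
  fixes u :: real
  assumes "M \<ge> 4" "u \<ge> 11 / 10"
  shows "(real M / real (Suc M)) powr (real (Suc M) * u) * (1 + real (Suc M) / (real (Suc M) * u - 1))
    \<le> exp (- u) * (1 + 1 / u)"
proof -
  define x where "x = 1 / real (Suc M)"
  have x: "0 < x" "x \<le> 1 / 5"
    using assms(1) by (auto simp: x_def field_simps)
  have base: "real M / real (Suc M) = 1 - x" and expo: "real (Suc M) * u = u / x"
    and inv: "real (Suc M) = 1 / x"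
    by (simp_all add: x_def field_simps)
  have "u / x * ln (1 - x) \<le> u / x * (- x - x\<^sup>2 / 2)"
    using x assms(2) by (intro mult_left_mono ln_one_minus_le_quadratic) auto
  also have "\<dots> = - u - u * x / 2"
    using x by (simp add: field_simps power2_eq_square)
  finally have pow: "(1 - x) powr (u / x) \<le> exp (- u) * exp (- (u * x / 2))"
    using x by (simp add: powr_def flip: exp_add)
  have "2 \<le> (11 / 10 - 1 / 5) * (11 / 10 + 1) * (11 / 10 :: real)"
    by simp
  also have "\<dots> \<le> (u - x) * (u + 1) * u"
    using x assms(2) by (intro mult_mono) auto
  finally have two: "2 \<le> (u - x) * (u + 1) * u" .
  have ux: "u - x > 0" using x assms(2) by simp
  have "1 + (1 / x) / (u / x - 1) = (1 + 1 / u) * (1 + x / ((u - x) * (u + 1)))"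
  proof -
    have "(1 / x) / (u / x - 1) = 1 / (u - x)"
      using x ux by (simp add: field_simps)
    moreover have "1 + 1 / (u - x) = (1 + 1 / u) * (1 + x / ((u - x) * (u + 1)))"
      using ux assms(2) by (simp add: divide_simps) (simp add: algebra_simps)
    ultimately show ?thesis by simp
  qed
  also have "\<dots> \<le> (1 + 1 / u) * exp (u * x / 2)"
  proof (rule mult_left_mono)
    have "1 / ((u - x) * (u + 1)) \<le> u / 2"
      using two ux assms(2) by (subst pos_divide_le_eq) (simp_all add: mult_ac)
    then have "x * (1 / ((u - x) * (u + 1))) \<le> x * (u / 2)"
      using x by (intro mult_left_mono) auto
    then have "1 + x / ((u - x) * (u + 1)) \<le> 1 + u * x / 2"
      by (simp add: mult.commute)
    also have "\<dots> \<le> exp (u * x / 2)"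
      by (rule exp_ge_add_one_self)
    finally show "1 + x / ((u - x) * (u + 1)) \<le> exp (u * x / 2)" .
  qed (use assms(2) in auto)
  finally have "(1 - x) powr (u / x) * (1 + (1 / x) / (u / x - 1)) \<le>
      (exp (- u) * exp (- (u * x / 2))) * ((1 + 1 / u) * exp (u * x / 2))"
    using ux x by (intro mult_mono pow) (auto simp: field_simps)
  also have "\<dots> = exp (- u) * (1 + 1 / u)"
    by (simp add: exp_minus field_simps)
  finally show ?thesis
    unfolding base expo unfolding inv .
qed

text \<open>
  The condition on \<open>u\<close> compares a decreasing function of \<open>u\<close> with 1. At \<open>u = 11 / 10\<close> this function
  is still larger than 1, as the bound \<open>exp (11 / 10) \<le> 16 / 5\<close> shows.
\<close>
lemma gap_parameter_ge:
  fixes u :: real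
  assumes "u > 0" "1 - 1 / (exp u - 1) - 1 / exp u * (1 + 1 / u) \<ge> 0"
  shows "u \<ge> 11 / 10"
proof (rule ccontr)
  assume "\<not> u \<ge> 11 / 10"
  then have u: "u < 11 / 10" by simp
  \<comment> \<open>The quadratic bound on \<open>exp\<close> is accurate enough only near zero, hence the eighth power.\<close>
  have "exp (11 / 80 :: real) \<le> 1 + 11 / 80 + (11 / 80)\<^sup>2"
    by (rule exp_bound) auto
  then have "exp (11 / 80 :: real) ^ 8 \<le> (1 + 11 / 80 + (11 / 80)\<^sup>2) ^ 8"
    by (rule power_mono) simp
  also have "\<dots> \<le> 16 / 5"
    by (simp add: power2_eq_square power_divide)
  also have "exp (11 / 80 :: real) ^ 8 = exp (11 / 10)"
    by (simp flip: exp_of_nat_mult)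
  finally have e: "exp u < 16 / 5"
    using u by (meson exp_less_mono less_le_trans)
  have "5 / 11 \<le> 1 / (exp u - 1)"
    using e assms(1) by (simp add: field_simps)
  moreover have "5 / 16 * (1 + 10 / 11) \<le> 1 / exp u * (1 + 1 / u)"
    using e u assms(1) by (intro mult_mono) (auto simp: field_simps)
  ultimately have "1 - 1 / (exp u - 1) - 1 / exp u * (1 + 1 / u) \<le> 1 - 5 / 11 - 5 / 16 * (1 + 10 / 11)"
    by (intro diff_mono order_refl)
  also have "\<dots> < 0" by simp
  finally show False
    using assms(2) by (meson leD)
qed

section \<open>The zero-free regions\<close>

text \<open>
  Reduces a numerical bound on a rational power to an inequality between rational numbers.
\<close>
lemma powr_le_of_power_le:
  fixes x c :: real
  assumes "0 < x" "0 < c" "0 < b" "x ^ a \<le> c ^ b"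
  shows "x powr (real a / real b) \<le> c"
proof -
  have "x powr (real a / real b) = (x ^ a) powr (1 / real b)"
    using assms(1) by (simp add: powr_powr flip: powr_realpow)
  also have "\<dots> \<le> (c ^ b) powr (1 / real b)"
    using assms by (intro powr_mono2) auto
  also have "\<dots> = c"
    using assms by (simp add: powr_powr flip: powr_realpow)
  finally show ?thesis .
qed

text \<open>
  To the right of \<open>qM 2 * \<alpha> + 2.6\<close> the term \<open>n = 2\<close> dominates: relative to it, the term \<open>n = 3\<close> is at most
  0.36, and the terms from \<open>n = 4\<close> on add up to at most \<open>0.17 * 3.5\<close>, in total 0.955.
\<close>
lemma eta_deriv_nonzero_right:
  assumes "\<alpha> > 0" "Re s > qM 2 * \<alpha> + 2.6"
  shows "eta_deriv \<alpha> s \<noteq> 0"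
proof -
  let ?f = "eta_weight \<alpha> (Re s)"
  have q: "0 \<le> qM 2 * \<alpha>" using qM_nonneg[of 2] assms(1) by simp
  have sg: "Re s > 1" using q assms(2) by simp
  have p: "2.6 \<le> Re s - qM 2 * \<alpha>" using assms(2) by simp
  have "(2 / 3) powr (real 13 / real 5) \<le> (36 / 100 :: real)" "(1 / 2) powr (real 13 / real 5) \<le> (17 / 100 :: real)"
    by (rule powr_le_of_power_le; simp add: power_divide)+
  then have num: "(2 / 3) powr 2.6 \<le> (36 / 100 :: real)" "(1 / 2) powr 2.6 \<le> (17 / 100 :: real)"
    by simp_all
  have "?f 3 \<le> ?f 2 * (2 / 3) powr 2.6"
    using eta_weight_le_above[of 2 3 \<alpha> "2.6" "Re s"] assms(1) p by simp
  also have "\<dots> \<le> ?f 2 * (36 / 100)"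
    by (intro mult_left_mono num eta_weight_nonneg)
  finally have f3: "?f 3 \<le> ?f 2 * (36 / 100)" .
  have "(\<Sum>k. ?f (k + 4)) \<le> ?f 2 * ((1 / 2) powr 2.6 * (1 + 4 / 1.6))"
    using eta_weight_tail_le[of 2 4 \<alpha> "2.6" "Re s"] assms(1) p by simp
  also have "\<dots> \<le> ?f 2 * (17 / 100 * (1 + 4 / 1.6))"
    by (intro mult_left_mono mult_right_mono num eta_weight_nonneg) auto
  finally have f4: "(\<Sum>k. ?f (k + 4)) \<le> ?f 2 * (17 / 100 * (1 + 4 / 1.6))" .
  have "(\<Sum>k. ?f (k + 3)) = ?f 3 + (\<Sum>k. ?f (k + 4))"
    using suminf_split_head[OF summable_eta_weight[OF sg, of \<alpha> 3]] by (simp add: add.commute)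
  also have "\<dots> < ?f 2"
    using f3 f4 eta_weight_pos[of 2 \<alpha> "Re s"] by simp
  finally show ?thesis
    using eta_deriv_nonzero_if_dominant[OF assms(1) sg, of 2] by simp
qed

lemma four_ln_3_ge: "4 * ln 3 \<ge> (35 / 8 :: real)"
  using ln_approx_bounds[of 3 3] by (simp add: eval_nat_numeral)

text \<open>
  Here the term \<open>n = 3\<close> dominates. Relative to it, the term \<open>n = 2\<close> is at most \<open>4 / 9\<close>. On the other
  side the decay has order \<open>4 * ln 3 \<ge> 35 / 8\<close>, so the term \<open>n = 4\<close> is at most 0.285 and the terms
  from \<open>n = 5\<close> on add up to less than 0.267. The total is just below 1; an integral comparison that
  starts at \<open>n = 4\<close> would give a bound above 1.
\<close>
lemma eta_deriv_nonzero_second_strip: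
  assumes "\<alpha> > 0" "qM 3 * \<alpha> + 4 * ln 3 \<le> Re s" "Re s \<le> qM 2 * \<alpha> - 2"
  shows "eta_deriv \<alpha> s \<noteq> 0"
proof -
  let ?f = "eta_weight \<alpha> (Re s)"
  have q: "0 \<le> qM 3 * \<alpha>" using qM_nonneg[of 3] assms(1) by simp
  have sg: "Re s > 1" using q assms(2) four_ln_3_ge by simp
  have p: "35 / 8 \<le> Re s - qM 3 * \<alpha>" using assms(2) four_ln_3_ge by simp
  have "(3 / 4) powr (real 35 / real 8) \<le> (285 / 1000 :: real)" "(3 / 5) powr (real 35 / real 8) \<le> (1075 / 10000 :: real)"
    by (rule powr_le_of_power_le; simp add: power_divide)+
  then have num: "(3 / 4) powr (35 / 8) \<le> (285 / 1000 :: real)" "(3 / 5) powr (35 / 8) \<le> (1075 / 10000 :: real)"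
    by simp_all
  have "?f 4 \<le> ?f 3 * (3 / 4) powr (35 / 8)"
    using eta_weight_le_above[of 3 4 \<alpha> "35 / 8" "Re s"] assms(1) p by simp
  also have "\<dots> \<le> ?f 3 * (285 / 1000)"
    by (intro mult_left_mono num eta_weight_nonneg)
  finally have f4: "?f 4 \<le> ?f 3 * (285 / 1000)" .
  have "(\<Sum>k. ?f (k + 5)) \<le> ?f 3 * ((3 / 5) powr (35 / 8) * (1 + 5 / (35 / 8 - 1)))"
    using eta_weight_tail_le[of 3 5 \<alpha> "35 / 8" "Re s"] assms(1) p by simp
  also have "\<dots> \<le> ?f 3 * (1075 / 10000 * (1 + 5 / (35 / 8 - 1)))"
    by (intro mult_left_mono mult_right_mono num eta_weight_nonneg) auto
  finally have f5: "(\<Sum>k. ?f (k + 5)) \<le> ?f 3 * (1075 / 10000 * (1 + 5 / (35 / 8 - 1)))" .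
  have f2: "?f 2 \<le> ?f 3 * (4 / 9)"
    using eta_weight_le_below[of 2 3 \<alpha> "2" "Re s"] assms(1,3) by (simp add: power_divide)
  have "(\<Sum>k. ?f (k + 4)) = ?f 4 + (\<Sum>k. ?f (k + 5))"
    using suminf_split_head[OF summable_eta_weight[OF sg, of \<alpha> 4]] by (simp add: add.commute)
  then have "?f 2 + (\<Sum>k. ?f (k + 4)) < ?f 3"
    using f2 f4 f5 eta_weight_pos[of 3 \<alpha> "Re s"] by simp
  moreover have "(\<Sum>n = 2..<3. ?f n) = ?f 2"
    by (simp add: numeral_3_eq_3 numeral_2_eq_2)
  ultimately show ?thesis
    using eta_deriv_nonzero_if_dominant[OF assms(1) sg, of 3] by simp
qed

text \<open>
  Relative to the dominant term \<open>n = M\<close>, the earlier terms add up to less than \<open>1 / (exp u - 1)\<close> and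
  the later ones to at most \<open>exp (- u) * (1 + 1 / u)\<close>; the condition on \<open>u\<close> says that these two
  bounds add up to at most 1.
\<close>
lemma eta_deriv_nonzero_strip:
  assumes "\<alpha> > 0" "u > 0" "1 - 1 / (exp u - 1) - 1 / exp u * (1 + 1 / u) \<ge> 0" "M > 3"
    and lower: "qM M * \<alpha> + (real M + 1) * u \<le> Re s"
    and upper: "Re s \<le> qM (M - 1) * \<alpha> - real M * u"
  shows "eta_deriv \<alpha> s \<noteq> 0"
proof -
  let ?f = "eta_weight \<alpha> (Re s)"
  let ?p = "real (Suc M) * u"
  have u: "u \<ge> 11 / 10" by (rule gap_parameter_ge[OF assms(2,3)])
  have "5 * (11 / 10) \<le> real (Suc M) * u"
    using assms(4) u by (intro mult_mono) auto
  then have p1: "?p > 1" by simp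
  have p: "?p \<le> Re s - qM M * \<alpha>" using lower by (simp add: add.commute)
  have q: "0 \<le> qM M * \<alpha>" using qM_nonneg[of M] assms(1,4) by simp
  have sg: "Re s > 1" using q p p1 by linarith
  have below: "(\<Sum>n = 2..<M. ?f n) < ?f M * (1 / (exp u - 1))"
    using assms(1,2,4) upper by (intro eta_weight_sum_below_less) auto
  have "(\<Sum>k. ?f (k + Suc M)) \<le> ?f M * ((real M / real (Suc M)) powr ?p * (1 + real (Suc M) / (?p - 1)))"
    using assms(1,4) p1 p by (intro eta_weight_tail_le) auto
  also have "\<dots> \<le> ?f M * (exp (- u) * (1 + 1 / u))"
    using assms(4) u by (intro mult_left_mono upper_tail_factor_le eta_weight_nonneg) auto
  finally have above: "(\<Sum>k. ?f (k + Suc M)) \<le> ?f M * (exp (- u) * (1 + 1 / u))" .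
  have "1 / (exp u - 1) + exp (- u) * (1 + 1 / u) \<le> 1"
    using assms(3) by (simp add: exp_minus divide_inverse)
  then have "?f M * (1 / (exp u - 1) + exp (- u) * (1 + 1 / u)) \<le> ?f M * 1"
    by (intro mult_left_mono eta_weight_nonneg)
  with below above have "(\<Sum>n = 2..<M. ?f n) + (\<Sum>k. ?f (k + Suc M)) < ?f M"
    by (simp only: distrib_left mult_1_right)
  then show ?thesis
    using assms(1,4) sg by (intro eta_deriv_nonzero_if_dominant) auto
qed

theorem theorem3p1:
  fixes \<alpha> :: real
  assumes "\<alpha> > 0"
  shows
    "(\<forall>s::complex. Re s > qM 2 * \<alpha> + 2.6 \<longrightarrow> eta_deriv \<alpha> s \<noteq> 0) \<and>
     (qM 3 * \<alpha> + 4 * ln 3 < qM 2 * \<alpha> - 2 \<longrightarrow>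
       (\<forall>s::complex. qM 3 * \<alpha> + 4 * ln 3 \<le> Re s \<and> Re s \<le> qM 2 * \<alpha> - 2 \<longrightarrow>
          eta_deriv \<alpha> s \<noteq> 0)) \<and>
     (\<forall>u::real. u > 0 \<and> 1 - 1 / (exp u - 1) - 1 / exp u * (1 + 1 / u) \<ge> 0 \<longrightarrow>
       (\<forall>M::nat. M > 3 \<and> qM M * \<alpha> + (real M + 1) * u \<le> qM (M - 1) * \<alpha> - real M * u \<longrightarrow>
         (\<forall>s::complex. qM M * \<alpha> + (real M + 1) * u \<le> Re s \<and>
             Re s \<le> qM (M - 1) * \<alpha> - real M * u \<longrightarrow> eta_deriv \<alpha> s \<noteq> 0)))"
  using eta_deriv_nonzero_right[OF assms] eta_deriv_nonzero_second_strip[OF assms]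
    eta_deriv_nonzero_strip[OF assms]
  by blast

end
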